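(* Let $X$ and $Y$ be locally convex Hausdorff topological vector spaces. If $F\colon X\rightrightarrows Y$ is a polyhedral convex multifunction, then $\mathrm{dom}\,F$ is a polyhedral convex set in $X$ and $\mathrm{rge}\,F$ is a polyhedral convex set in $Y$.
   Context: All vector spaces are real. A subset $D$ of a locally convex Hausdorff topological vector space $X$ is a polyhedral convex set if there exist finitely many continuous linear functionals $x_i^*\in X^*$ and $\alpha_i\in\mathbb{R}$, $i=1,\dots,m$, with $D=\{x\in X\mid \langle x_i^*,x\rangle\le\alpha_i,\ i=1,\dots,m\}$. The empty set counts as polyhedral convex. A multifunction $F\colon X\rightrightarrows Y$ assigns to each $x\in X$ a (possibly empty) subset $F(x)\subset Y$; $\mathrm{dom}\,F=\{x\mid F(x)\neq\emptyset\}$, $\mathrm{rge}\,F=\{y\in Y\mid\exists x\in X:\ y\in F(x)\}$, $\mathrm{gph}\,F=\{(x,y)\in X\times Y\mid y\in F(x)\}$. $F$ is polyhedral convex if $\mathrm{gph}\,F$ is a polyhedral convex set in $X\times Y$. *)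

theory Defs
  imports "HOL-Analysis.Analysis"
begin

text \<open>Locally convex Hausdorff topological vector spaces over the reals.  Continuity of addition
  and negation comes from \<^class>\<open>topological_ab_group_add\<close>, separation from \<^class>\<open>t2_space\<close>;
  continuity of scalar multiplication is joint, on \<open>\<real> \<times> X\<close>.
  The library's \<open>convex\<close> carries a sort constraint that rules it out in a class specification, so it
  is unfolded there.\<close>

class locally_convex_space = real_vector + topological_ab_group_add + t2_space +
  assumes tendsto_scaleR_Pair: "LIM p (nhds (r::real) \<times>\<^sub>F nhds a). fst p *\<^sub>R snd p :> nhds (r *\<^sub>R a)"
    and convex_neighbourhood_base_unfolded:
      "open U \<Longrightarrow> 0 \<in> U \<Longrightarrow> \<exists>V. open V \<and> 0 \<in> V \<and>
        (\<forall>x\<in>V. \<forall>y\<in>V. \<forall>u\<ge>0. \<forall>v\<ge>0. u + v = 1 \<longrightarrow> u *\<^sub>R x + v *\<^sub>R y \<in> V) \<and> V \<subseteq> U"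

lemma convex_neighbourhood_base:
  fixes U :: "'a::locally_convex_space set"
  assumes "open U" "0 \<in> U"
  shows "\<exists>V. open V \<and> 0 \<in> V \<and> convex V \<and> V \<subseteq> U"
  using convex_neighbourhood_base_unfolded[OF assms] by (simp only: convex_def)

lemma tendsto_scaleR_lcs:
  fixes a :: "'a::locally_convex_space" and r :: real
  assumes "(f \<longlongrightarrow> r) F" "(g \<longlongrightarrow> a) F"
  shows "((\<lambda>x. f x *\<^sub>R g x) \<longlongrightarrow> r *\<^sub>R a) F"
  using filterlim_compose[OF tendsto_scaleR_Pair, of "\<lambda>x. (f x, g x)" r a F] assms
  by (simp add: nhds_prod[symmetric] tendsto_Pair)

instance real_normed_vector \<subseteq> locally_convex_space
proof
  show "LIM p (nhds r \<times>\<^sub>F nhds a). fst p *\<^sub>R snd p :> nhds (r *\<^sub>R a)" for r :: real and a :: 'a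
    by (intro tendsto_scaleR filterlim_fst filterlim_snd)
  fix U :: "'a set" assume "open U" "0 \<in> U"
  then obtain e where "e > 0" "ball 0 e \<subseteq> U"
    using open_contains_ball by blast
  then have "\<exists>V. open V \<and> 0 \<in> V \<and> convex V \<and> V \<subseteq> U"
    by (intro exI[of _ "ball 0 e"]) auto
  then show "\<exists>V. open V \<and> 0 \<in> V \<and>
      (\<forall>x\<in>V. \<forall>y\<in>V. \<forall>u\<ge>0. \<forall>v\<ge>0. u + v = 1 \<longrightarrow> u *\<^sub>R x + v *\<^sub>R y \<in> V) \<and> V \<subseteq> U"
    by (simp only: convex_def)
qed

text \<open>The product type carries the product topology and the componentwise linear structure.\<close>

instance prod :: (topological_monoid_add, topological_monoid_add) topological_monoid_add
proof
  show "((\<lambda>x. fst x + snd x) \<longlongrightarrow> a + b) (nhds a \<times>\<^sub>F nhds b)" for a b :: "'a \<times> 'b"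
  proof -
    have F: "filterlim fst (nhds a) (nhds a \<times>\<^sub>F nhds b)" "filterlim snd (nhds b) (nhds a \<times>\<^sub>F nhds b)"
      by (rule filterlim_fst filterlim_snd)+
    have "((\<lambda>x. (fst (fst x) + fst (snd x), snd (fst x) + snd (snd x)))
        \<longlongrightarrow> (fst a + fst b, snd a + snd b)) (nhds a \<times>\<^sub>F nhds b)"
      by (intro tendsto_Pair tendsto_add tendsto_fst tendsto_snd F)
    then show ?thesis by (simp add: plus_prod_def)
  qed
qed

instance prod :: (topological_comm_monoid_add, topological_comm_monoid_add) topological_comm_monoid_add ..

instance prod :: (topological_group_add, topological_group_add) topological_group_add
proof
  show "(uminus \<longlongrightarrow> - a) (nhds a)" for a :: "'a \<times> 'b"
  proof -
    have F: "filterlim (\<lambda>x. x) (nhds a) (nhds a)" by (rule filterlim_ident)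
    have eq: "uminus = (\<lambda>x :: 'a \<times> 'b. (- fst x, - snd x))" by (simp add: fun_eq_iff uminus_prod_def)
    show ?thesis
      unfolding eq by (intro tendsto_Pair tendsto_minus tendsto_fst tendsto_snd F)
  qed
qed

instance prod :: (topological_ab_group_add, topological_ab_group_add) topological_ab_group_add ..

instance prod :: (locally_convex_space, locally_convex_space) locally_convex_space
proof
  show "LIM p (nhds r \<times>\<^sub>F nhds a). fst p *\<^sub>R snd p :> nhds (r *\<^sub>R a)" for r :: real and a :: "'a \<times> 'b"
  proof -
    have F: "filterlim fst (nhds r) (nhds r \<times>\<^sub>F nhds a)" "filterlim snd (nhds a) (nhds r \<times>\<^sub>F nhds a)"
      by (rule filterlim_fst filterlim_snd)+
    have "((\<lambda>p. (fst p *\<^sub>R fst (snd p), fst p *\<^sub>R snd (snd p)))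
        \<longlongrightarrow> (r *\<^sub>R fst a, r *\<^sub>R snd a)) (nhds r \<times>\<^sub>F nhds a)"
      by (intro tendsto_Pair tendsto_scaleR_lcs tendsto_fst tendsto_snd F)
    then show ?thesis by (simp add: scaleR_prod_def)
  qed
  fix U :: "('a \<times> 'b) set" assume "open U" "0 \<in> U"
  then obtain A B where AB: "open A" "open B" "0 \<in> A \<times> B" "A \<times> B \<subseteq> U"
    by (rule open_prod_elim)
  obtain V where V: "open V" "0 \<in> V" "convex V" "V \<subseteq> A"
    using convex_neighbourhood_base[of A] AB by (auto simp: zero_prod_def)
  obtain W where W: "open W" "0 \<in> W" "convex W" "W \<subseteq> B"
    using convex_neighbourhood_base[of B] AB by (auto simp: zero_prod_def)
  have "\<exists>V. open V \<and> 0 \<in> V \<and> convex V \<and> V \<subseteq> U"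
    using V W AB(4)
    by (intro exI[of _ "V \<times> W"]) (auto simp: zero_prod_def intro: open_Times convex_Times)
  then show "\<exists>V. open V \<and> 0 \<in> V \<and>
      (\<forall>x\<in>V. \<forall>y\<in>V. \<forall>u\<ge>0. \<forall>v\<ge>0. u + v = 1 \<longrightarrow> u *\<^sub>R x + v *\<^sub>R y \<in> V) \<and> V \<subseteq> U"
    by (simp only: convex_def)
qed

text \<open>The functionals \<open>f i\<close> range over the topological dual.  The case \<open>m = 0\<close> gives the whole space;
  the zero functional is allowed, so no separate clause is needed for the empty set.\<close>

definition polyhedral_convex :: "'a::locally_convex_space set \<Rightarrow> bool" where
  "polyhedral_convex D \<longleftrightarrow>
    (\<exists>(m::nat) (f :: nat \<Rightarrow> 'a \<Rightarrow> real) (\<alpha> :: nat \<Rightarrow> real).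
      (\<forall>i\<in>{1..m}. linear (f i) \<and> continuous_on UNIV (f i)) \<and>
      D = {x. \<forall>i\<in>{1..m}. f i x \<le> \<alpha> i})"

lemma polyhedral_convex_empty: "polyhedral_convex ({} :: 'a::locally_convex_space set)"
  unfolding polyhedral_convex_def
  by (rule exI[of _ 1], rule exI[of _ "\<lambda>_ _. 0"], rule exI[of _ "\<lambda>_. -1"])
    (auto simp: linear_zero)

definition mf_dom :: "('a \<Rightarrow> 'b set) \<Rightarrow> 'a set" where
  "mf_dom F = {x. F x \<noteq> {}}"

definition mf_rge :: "('a \<Rightarrow> 'b set) \<Rightarrow> 'b set" where
  "mf_rge F = {y. \<exists>x. y \<in> F x}"

definition mf_gph :: "('a \<Rightarrow> 'b set) \<Rightarrow> ('a \<times> 'b) set" where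
  "mf_gph F = {(x, y). y \<in> F x}"

definition polyhedral_convex_multifunction ::
    "('a::locally_convex_space \<Rightarrow> 'b::locally_convex_space set) \<Rightarrow> bool" where
  "polyhedral_convex_multifunction F \<longleftrightarrow> polyhedral_convex (mf_gph F)"

end

theory Submission
  imports Defs
begin

text \<open>
  The graph of \<open>F\<close> is cut out by finitely many inequalities \<open>f x + g y \<le> a\<close>, and domain and range are
  its projections, so everything rests on eliminating \<open>y\<close> (or \<open>x\<close>) from such a system.  This is
  Fourier--Motzkin elimination, with one adjustment for spaces of infinite dimension.  A finite set
  of functionals \<open>g\<close> cannot distinguish \<open>y\<close> from a suitable vector of some finite-dimensional span
  (\<open>finitely_many_functionals_factor_through_finite_span\<close>), hence only finitely many real unknowns
  need to be eliminated, namely coefficients along the spanning vectors.  Eliminating one real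
  unknown \<open>k\<close> is elementary: the inequalities bound \<open>k\<close> from above or from below, and a solution
  exists precisely when each lower bound is at most each upper bound (\<open>ex_scalar_solution_iff\<close>).

  The inequalities that arise are nonnegative combinations of the original ones.  Therefore the
  functionals in the remaining variable stay linear and continuous; no closedness argument, and no
  separation theorem, enters.
\<close>

section \<open>Polyhedral sets as finite systems of inequalities\<close>

text \<open>
  Elimination replaces a system by a union of derived systems; with sets in place of numbered
  families this requires no renumbering.
\<close>

lemma polyhedral_convex_iff_finite_system:
  fixes D :: "'a::locally_convex_space set"
  shows "polyhedral_convex D \<longleftrightarrow>
    (\<exists>S. finite S \<and> (\<forall>(f, a)\<in>S. linear f \<and> continuous_on UNIV f) \<and>
      D = {x. \<forall>(f, a)\<in>S. f x \<le> (a::real)})"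
    (is "?P \<longleftrightarrow> (\<exists>S. ?Q S)")
proof
  assume ?P
  then obtain m :: nat and f :: "nat \<Rightarrow> 'a \<Rightarrow> real" and \<alpha>
    where mf: "\<forall>i\<in>{1..m}. linear (f i) \<and> continuous_on UNIV (f i)"
      "D = {x. \<forall>i\<in>{1..m}. f i x \<le> \<alpha> i}"
    unfolding polyhedral_convex_def by blast
  have "?Q ((\<lambda>i. (f i, \<alpha> i)) ` {1..m})"
    using mf by auto
  then show "\<exists>S. ?Q S" ..
next
  assume "\<exists>S. ?Q S"
  then obtain S where S: "?Q S" ..
  then obtain h where h: "bij_betw h {1..card S} S"
    using ex_bij_betw_nat_finite_1 by blast
  then have hS: "h ` {1..card S} = S"
    by (simp add: bij_betw_def)
  have "\<forall>i\<in>{1..card S}. linear (fst (h i)) \<and> continuous_on UNIV (fst (h i))"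
  proof
    fix i assume "i \<in> {1..card S}"
    then have "h i \<in> S" using hS by blast
    then show "linear (fst (h i)) \<and> continuous_on UNIV (fst (h i))"
      using S by (auto simp: case_prod_unfold)
  qed
  moreover have "D = {x. \<forall>i\<in>{1..card S}. fst (h i) x \<le> snd (h i)}"
  proof -
    have "D = {x. \<forall>p\<in>h ` {1..card S}. fst p x \<le> snd p}"
      using S unfolding hS by (simp add: case_prod_unfold)
    then show ?thesis by simp
  qed
  ultimately show ?P
    unfolding polyhedral_convex_def
    by (intro exI[of _ "card S"] exI[of _ "\<lambda>i. fst (h i)"] exI[of _ "\<lambda>i. snd (h i)"] conjI)
qed

section \<open>Eliminating one real unknown\<close>

lemma ex_between_finite_sets:
  fixes L U :: "real set"
  assumes "finite L" "finite U" and le: "\<And>l u. l \<in> L \<Longrightarrow> u \<in> U \<Longrightarrow> l \<le> u"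
  shows "\<exists>t. (\<forall>l\<in>L. l \<le> t) \<and> (\<forall>u\<in>U. t \<le> u)"
proof (cases "L = {}")
  case True
  then show ?thesis
    using \<open>finite U\<close> by (intro exI[of _ "Min (insert 0 U)"]) auto
next
  case False
  then show ?thesis
    using \<open>finite L\<close> le by (intro exI[of _ "Max L"]) (auto simp: Max_le_iff)
qed

text \<open>
  An inequality with \<open>c i > 0\<close> is the upper bound \<open>b i / c i\<close> on \<open>t\<close>, one with \<open>c j < 0\<close> the lower
  bound \<open>b j / c j\<close>.  The comparison of the two is stated with denominators cleared, so that it is
  linear in \<open>b\<close>.
\<close>

lemma ex_scalar_solution_iff:
  fixes b c :: "'i \<Rightarrow> real"
  assumes "finite I"
  shows "(\<exists>t. \<forall>i\<in>I. t * c i \<le> b i) \<longleftrightarrow>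
    (\<forall>i\<in>I. c i = 0 \<longrightarrow> 0 \<le> b i) \<and>
    (\<forall>i\<in>I. \<forall>j\<in>I. 0 < c i \<longrightarrow> c j < 0 \<longrightarrow> c j * b i \<le> c i * b j)"
    (is "?L \<longleftrightarrow> ?R")
proof
  assume ?L
  then obtain t where t: "\<And>i. i \<in> I \<Longrightarrow> t * c i \<le> b i" by blast
  show ?R
  proof (intro conjI ballI impI)
    show "0 \<le> b i" if "i \<in> I" "c i = 0" for i
      using t[OF that(1)] that(2) by simp
    fix i j assume ij: "i \<in> I" "j \<in> I" "0 < c i" "c j < 0"
    have "c j * b i \<le> c j * (t * c i)"
      using t[OF ij(1)] ij(4) by (intro mult_left_mono_neg) auto
    also have "\<dots> = c i * (t * c j)" by simp
    also have "\<dots> \<le> c i * b j"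
      using t[OF ij(2)] ij(3) by (intro mult_left_mono) auto
    finally show "c j * b i \<le> c i * b j" .
  qed
next
  assume R: ?R
  define L where "L = (\<lambda>j. b j / c j) ` {j \<in> I. c j < 0}"
  define U where "U = (\<lambda>i. b i / c i) ` {i \<in> I. 0 < c i}"
  have "\<exists>t. (\<forall>l\<in>L. l \<le> t) \<and> (\<forall>u\<in>U. t \<le> u)"
  proof (rule ex_between_finite_sets)
    show "finite L" "finite U"
      using assms by (auto simp: L_def U_def)
    fix l u assume "l \<in> L" "u \<in> U"
    then obtain i j where ij: "i \<in> I" "j \<in> I" "0 < c i" "c j < 0" "l = b j / c j" "u = b i / c i"
      by (auto simp: L_def U_def)
    then have "c j * b i \<le> c i * b j" using R by blast
    then show "l \<le> u"
      unfolding ij(5,6) using ij(3,4) by (simp add: field_simps)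
  qed
  then obtain t where t: "\<forall>l\<in>L. l \<le> t" "\<forall>u\<in>U. t \<le> u" by blast
  have "t * c i \<le> b i" if i: "i \<in> I" for i
  proof (cases "c i" "0::real" rule: linorder_cases)
    case less
    then have "b i / c i \<le> t" using t(1) i by (auto simp: L_def)
    then show ?thesis using less by (simp add: neg_divide_le_eq)
  next
    case equal
    then show ?thesis using R i by simp
  next
    case greater
    then have "t \<le> b i / c i" using t(2) i by (auto simp: U_def)
    then show ?thesis using greater by (simp add: pos_le_divide_eq)
  qed
  then show ?L by blast
qed

section \<open>Eliminating a vector unknown\<close>

text \<open>
  Induction on the set of functionals: a new functional either vanishes on the common kernel of the
  earlier ones and then separates no further points, or it takes the value 1 at some vector \<open>e\<close> of
  that kernel, and adding \<open>e\<close> to the spanning set corrects its value without disturbing the others.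
\<close>

lemma finitely_many_functionals_factor_through_finite_span:
  fixes G :: "('b::real_vector \<Rightarrow> real) set"
  assumes "finite G" "\<And>g. g \<in> G \<Longrightarrow> linear g"
  shows "\<exists>E. finite E \<and> (\<forall>y. \<exists>z\<in>span E. \<forall>g\<in>G. g z = g y)"
  using assms
proof (induction G)
  case empty
  show ?case by (rule exI[of _ "{}"]) auto
next
  case (insert h G)
  then obtain E where E: "finite E" "\<And>y. \<exists>z\<in>span E. \<forall>g\<in>G. g z = g y" by auto
  have lin: "linear h" "\<And>g. g \<in> G \<Longrightarrow> linear g" using insert.prems by auto
  show ?case
  proof (cases "\<forall>v. (\<forall>g\<in>G. g v = 0) \<longrightarrow> h v = 0")
    case True
    have "\<exists>z\<in>span E. \<forall>g\<in>insert h G. g z = g y" for y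
    proof -
      obtain z where z: "z \<in> span E" "\<forall>g\<in>G. g z = g y" using E(2) by blast
      then have "\<forall>g\<in>G. g (z - y) = 0" by (simp add: lin(2) linear_diff)
      then have "h (z - y) = 0" using True by blast
      then show ?thesis using z lin(1) by (auto simp: linear_diff)
    qed
    then show ?thesis using E(1) by blast
  next
    case False
    then obtain v where v: "\<forall>g\<in>G. g v = 0" "h v \<noteq> 0" by blast
    define e where "e = (1 / h v) *\<^sub>R v"
    have e: "\<forall>g\<in>G. g e = 0" "h e = 1"
      using v lin by (simp_all add: e_def linear_cmul)
    have "\<exists>z\<in>span (insert e E). \<forall>g\<in>insert h G. g z = g y" for y
    proof -
      obtain z where z: "z \<in> span E" "\<forall>g\<in>G. g z = g y" using E(2) by blast
      let ?z = "z + (h y - h z) *\<^sub>R e"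
      have "?z \<in> span (insert e E)"
        using z(1) span_mono[of E "insert e E"]
        by (intro span_add span_mul) (auto intro: span_base)
      moreover have "\<forall>g\<in>insert h G. g ?z = g y"
        using z(2) e lin by (auto simp: linear_add linear_cmul)
      ultimately show ?thesis by blast
    qed
    then show ?thesis using E(1) by blast
  qed
qed

text \<open>
  The induction removes one spanning vector \<open>e\<close> at a time: an element of \<open>span (insert e E)\<close> is
  \<open>z + k *\<^sub>R e\<close> with \<open>z \<in> span E\<close>, and eliminating \<open>k\<close> leaves a system of the same kind in \<open>x\<close> and \<open>z\<close>.
  The system varies along the induction.
\<close>

lemma polyhedral_convex_eliminate_span:
  fixes S :: "(('a::locally_convex_space \<Rightarrow> real) \<times> ('b::real_vector \<Rightarrow> real) \<times> real) set"
  assumes "finite E" "finite S"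
    and "\<And>f g a. (f, g, a) \<in> S \<Longrightarrow> linear f \<and> continuous_on UNIV f \<and> linear g"
  shows "polyhedral_convex {x. \<exists>y\<in>span E. \<forall>(f, g, a)\<in>S. f x + g y \<le> a}"
  using assms
proof (induction E arbitrary: S)
  case empty
  let ?T = "(\<lambda>(f, g, a). (f, a)) ` S"
  have "finite ?T" "\<forall>(f, a)\<in>?T. linear f \<and> continuous_on UNIV f"
    using empty by fastforce+
  moreover have "{x. \<exists>y\<in>span {}. \<forall>(f, g, a)\<in>S. f x + g y \<le> a} = {x. \<forall>(f, a)\<in>?T. f x \<le> a}"
    using empty.prems(2) by (fastforce simp: linear_0)
  ultimately show ?case
    unfolding polyhedral_convex_iff_finite_system by blast
next
  case (insert e E)
  note lin = insert.prems(2)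
  \<comment> \<open>Both weights \<open>g e\<close> and \<open>- g' e\<close> are positive on \<open>W\<close>, and with them the functional in the
    second variable vanishes at \<open>e\<close>, so \<open>k\<close> cancels.\<close>
  define comb :: "(('a \<Rightarrow> real) \<times> ('b \<Rightarrow> real) \<times> real) \<times> (('a \<Rightarrow> real) \<times> ('b \<Rightarrow> real) \<times> real)
      \<Rightarrow> ('a \<Rightarrow> real) \<times> ('b \<Rightarrow> real) \<times> real"
    where "comb = (\<lambda>((f, g, a), (f', g', a')).
      (\<lambda>x. g e * f' x - g' e * f x, \<lambda>y. g e * g' y - g' e * g y, g e * a' - g' e * a))"
  define Z where "Z = {p \<in> S. fst (snd p) e = 0}"
  define W where "W = {(p, q). p \<in> S \<and> q \<in> S \<and> 0 < fst (snd p) e \<and> fst (snd q) e < 0}"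
  let ?S' = "Z \<union> comb ` W"
  have "W \<subseteq> S \<times> S" by (auto simp: W_def)
  then have "finite W"
    using \<open>finite S\<close> by (simp add: finite_subset)
  then have fin: "finite ?S'"
    using \<open>finite S\<close> by (simp add: Z_def)
  have admissible: "linear f \<and> continuous_on UNIV f \<and> linear g" if "(f, g, a) \<in> ?S'" for f g a
    using that
  proof
    assume "(f, g, a) \<in> Z"
    then show ?thesis using lin by (auto simp: Z_def)
  next
    assume "(f, g, a) \<in> comb ` W"
    then obtain f1 g1 a1 f2 g2 a2 where
      S: "(f1, g1, a1) \<in> S" "(f2, g2, a2) \<in> S"
      and fg: "f = (\<lambda>x. g1 e * f2 x - g2 e * f1 x)" "g = (\<lambda>y. g1 e * g2 y - g2 e * g1 y)"
      by (auto simp: W_def comb_def)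
    note l = lin[OF S(1)] lin[OF S(2)]
    have "linear f" "linear g"
      using l unfolding fg by (auto intro!: linearI simp: linear_add linear_cmul algebra_simps)
    moreover have "continuous_on UNIV f"
      using l unfolding fg by (intro continuous_on_diff continuous_on_mult_left) auto
    ultimately show ?thesis by blast
  qed
  have step: "(\<exists>k. \<forall>(f, g, a)\<in>S. f x + g (z + k *\<^sub>R e) \<le> a) \<longleftrightarrow> (\<forall>(f, g, a)\<in>?S'. f x + g z \<le> a)"
    for x z
  proof -
    define c where "c = (\<lambda>p::('a \<Rightarrow> real) \<times> ('b \<Rightarrow> real) \<times> real. fst (snd p) e)"
    define b where "b = (\<lambda>p::('a \<Rightarrow> real) \<times> ('b \<Rightarrow> real) \<times> real. snd (snd p) - fst p x - fst (snd p) z)"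
    have "(\<exists>k. \<forall>(f, g, a)\<in>S. f x + g (z + k *\<^sub>R e) \<le> a) \<longleftrightarrow> (\<exists>k. \<forall>p\<in>S. k * c p \<le> b p)"
    proof -
      have "(case p of (f, g, a) \<Rightarrow> f x + g (z + k *\<^sub>R e) \<le> a) \<longleftrightarrow> k * c p \<le> b p"
        if "p \<in> S" for p k
        using that lin by (cases p) (auto simp: b_def c_def linear_add linear_cmul)
      then show ?thesis by (intro ex_cong1 ball_cong) auto
    qed
    also have "\<dots> \<longleftrightarrow> (\<forall>p\<in>S. c p = 0 \<longrightarrow> 0 \<le> b p) \<and>
        (\<forall>p\<in>S. \<forall>q\<in>S. 0 < c p \<longrightarrow> c q < 0 \<longrightarrow> c q * b p \<le> c p * b q)"
      by (rule ex_scalar_solution_iff[OF \<open>finite S\<close>])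
    also have "(\<forall>p\<in>S. c p = 0 \<longrightarrow> 0 \<le> b p) \<longleftrightarrow> (\<forall>(f, g, a)\<in>Z. f x + g z \<le> a)"
      by (fastforce simp: Z_def c_def b_def)
    also have "(\<forall>p\<in>S. \<forall>q\<in>S. 0 < c p \<longrightarrow> c q < 0 \<longrightarrow> c q * b p \<le> c p * b q) \<longleftrightarrow>
        (\<forall>(f, g, a)\<in>comb ` W. f x + g z \<le> a)"
    proof -
      have "c q * b p \<le> c p * b q \<longleftrightarrow> (case comb (p, q) of (f, g, a) \<Rightarrow> f x + g z \<le> a)" for p q
        by (cases p; cases q) (auto simp: comb_def c_def b_def algebra_simps)
      moreover have "(\<forall>r\<in>comb ` W. P r) \<longleftrightarrow>
          (\<forall>p\<in>S. \<forall>q\<in>S. 0 < c p \<longrightarrow> c q < 0 \<longrightarrow> P (comb (p, q)))" for P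
        unfolding W_def c_def by blast
      ultimately show ?thesis by simp
    qed
    finally show ?thesis by (simp only: ball_Un)
  qed
  have "{x. \<exists>y\<in>span (insert e E). \<forall>(f, g, a)\<in>S. f x + g y \<le> a} =
      {x. \<exists>z\<in>span E. \<forall>(f, g, a)\<in>?S'. f x + g z \<le> a}"
  proof -
    have "(\<exists>y\<in>span (insert e E). P y) \<longleftrightarrow> (\<exists>z\<in>span E. \<exists>k. P (z + k *\<^sub>R e))" for P
    proof
      assume "\<exists>y\<in>span (insert e E). P y"
      then obtain y k where "P y" "y - k *\<^sub>R e \<in> span E"
        by (auto simp: span_breakdown_eq)
      then show "\<exists>z\<in>span E. \<exists>k. P (z + k *\<^sub>R e)"
        by (intro bexI[of _ "y - k *\<^sub>R e"] exI[of _ k]) auto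
    next
      assume "\<exists>z\<in>span E. \<exists>k. P (z + k *\<^sub>R e)"
      then obtain z k where "P (z + k *\<^sub>R e)" "z \<in> span E" by blast
      then show "\<exists>y\<in>span (insert e E). P y"
        by (intro bexI[of _ "z + k *\<^sub>R e"]) (auto simp: span_breakdown_eq intro!: exI[of _ k])
    qed
    then show ?thesis by (simp only: step)
  qed
  then show ?case
    using insert.IH[OF fin admissible] by simp
qed

lemma polyhedral_convex_eliminate:
  fixes S :: "(('a::locally_convex_space \<Rightarrow> real) \<times> ('b::real_vector \<Rightarrow> real) \<times> real) set"
  assumes "finite S"
    and "\<And>f g a. (f, g, a) \<in> S \<Longrightarrow> linear f \<and> continuous_on UNIV f \<and> linear g"
  shows "polyhedral_convex {x. \<exists>y. \<forall>(f, g, a)\<in>S. f x + g y \<le> a}"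
proof -
  let ?G = "(\<lambda>(f, g, a). g) ` S"
  have "finite ?G" "\<And>g. g \<in> ?G \<Longrightarrow> linear g"
    using assms by auto
  then obtain E where E: "finite E" "\<And>y. \<exists>z\<in>span E. \<forall>g\<in>?G. g z = g y"
    using finitely_many_functionals_factor_through_finite_span[of ?G] by blast
  have "(\<exists>y. \<forall>(f, g, a)\<in>S. f x + g y \<le> a) \<longleftrightarrow> (\<exists>y\<in>span E. \<forall>(f, g, a)\<in>S. f x + g y \<le> a)" for x
  proof
    assume "\<exists>y. \<forall>(f, g, a)\<in>S. f x + g y \<le> a"
    then obtain y where y: "\<forall>(f, g, a)\<in>S. f x + g y \<le> a" ..
    obtain z where z: "z \<in> span E" "\<forall>g\<in>?G. g z = g y" using E(2) by blast
    have "\<forall>(f, g, a)\<in>S. f x + g z \<le> a"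
      using y z(2) by fastforce
    then show "\<exists>y\<in>span E. \<forall>(f, g, a)\<in>S. f x + g y \<le> a" using z(1) by blast
  qed blast
  then show ?thesis
    using polyhedral_convex_eliminate_span[OF E(1) assms] by simp
qed

section \<open>Domain and range as projections of the graph\<close>

lemma polyhedral_convex_fst_snd_image:
  fixes D :: "('a::locally_convex_space \<times> 'b::locally_convex_space) set"
  assumes "polyhedral_convex D"
  shows "polyhedral_convex (fst ` D)" "polyhedral_convex (snd ` D)"
proof -
  obtain S where fin: "finite S" and lin: "\<forall>(f, a)\<in>S. linear f \<and> continuous_on UNIV f"
    and D: "D = {p. \<forall>(f, a)\<in>S. f p \<le> (a::real)}"
    using assms unfolding polyhedral_convex_iff_finite_system by blast
  have split: "f (x, y) = f (x, 0) + f (0, y)" if "(f, a) \<in> S" for f a x y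
  proof -
    have "linear f" using lin that by blast
    then have "f ((x, 0) + (0, y)) = f (x, 0) + f (0, y)" by (rule linear_add)
    then show ?thesis by simp
  qed
  have l1: "linear (\<lambda>x. f (x, 0)) \<and> continuous_on UNIV (\<lambda>x. f (x, 0))" if "(f, a) \<in> S" for f a
  proof
    have f: "linear f" "continuous_on UNIV f" using lin that by auto
    show "linear (\<lambda>x. f (x, 0))"
      using linear_add[OF f(1), of "(_, 0)" "(_, 0)"] linear_cmul[OF f(1), of _ "(_, 0)"]
      by (intro linearI) auto
    show "continuous_on UNIV (\<lambda>x. f (x, 0))"
      by (rule continuous_on_compose2[OF f(2)]) (auto intro!: continuous_intros)
  qed
  have l2: "linear (\<lambda>y. f (0, y)) \<and> continuous_on UNIV (\<lambda>y. f (0, y))" if "(f, a) \<in> S" for f a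
  proof
    have f: "linear f" "continuous_on UNIV f" using lin that by auto
    show "linear (\<lambda>y. f (0, y))"
      using linear_add[OF f(1), of "(0, _)" "(0, _)"] linear_cmul[OF f(1), of _ "(0, _)"]
      by (intro linearI) auto
    show "continuous_on UNIV (\<lambda>y. f (0, y))"
      by (rule continuous_on_compose2[OF f(2)]) (auto intro!: continuous_intros)
  qed
  have mem: "(x, y) \<in> D \<longleftrightarrow> (\<forall>(f, a)\<in>S. f (x, 0) + f (0, y) \<le> a)" for x y
  proof -
    have "(case p of (f, a) \<Rightarrow> f (x, y) \<le> a) \<longleftrightarrow> (case p of (f, a) \<Rightarrow> f (x, 0) + f (0, y) \<le> a)"
      if "p \<in> S" for p
    proof (cases p)
      case (Pair f a)
      then have "f (x, y) = f (x, 0) + f (0, y)" using that by (blast intro: split)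
      with Pair show ?thesis by (simp only: prod.case)
    qed
    then show ?thesis unfolding D mem_Collect_eq by (rule ball_cong[OF refl])
  qed
  let ?S1 = "(\<lambda>(f, a). (\<lambda>x. f (x, 0), \<lambda>y. f (0, y), a)) ` S"
  let ?S2 = "(\<lambda>(f, a). (\<lambda>y. f (0, y), \<lambda>x. f (x, 0), a)) ` S"
  have "polyhedral_convex {x. \<exists>y. \<forall>(f, g, a)\<in>?S1. f x + g y \<le> a}"
    by (rule polyhedral_convex_eliminate) (use fin l1 l2 in auto)
  moreover have "{x. \<exists>y. \<forall>(f, g, a)\<in>?S1. f x + g y \<le> a} = {x. \<exists>y. (x, y) \<in> D}"
    unfolding mem by (simp add: case_prod_unfold)
  moreover have "\<dots> = fst ` D" by force
  ultimately show "polyhedral_convex (fst ` D)" by simp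
  have "polyhedral_convex {y. \<exists>x. \<forall>(f, g, a)\<in>?S2. f y + g x \<le> a}"
    by (rule polyhedral_convex_eliminate) (use fin l1 l2 in auto)
  moreover have "{y. \<exists>x. \<forall>(f, g, a)\<in>?S2. f y + g x \<le> a} = {y. \<exists>x. (x, y) \<in> D}"
    unfolding mem by (simp add: case_prod_unfold add.commute)
  moreover have "\<dots> = snd ` D" by force
  ultimately show "polyhedral_convex (snd ` D)" by simp
qed

theorem theorem3p4:
  fixes F :: "'a::locally_convex_space \<Rightarrow> 'b::locally_convex_space set"
  assumes "polyhedral_convex_multifunction F"
  shows "polyhedral_convex (mf_dom F) \<and> polyhedral_convex (mf_rge F)"
proof -
  have "mf_dom F = fst ` mf_gph F" "mf_rge F = snd ` mf_gph F"
    by (force simp: mf_dom_def mf_rge_def mf_gph_def)+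
  then show ?thesis
    using assms polyhedral_convex_fst_snd_image
    unfolding polyhedral_convex_multifunction_def by metis
qed

end
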